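(* Let $u^k$, $b^k$ and $d^k$ be the sequences produced by Algorithm 1 (described in the context) for the data $(f,a)$. Then $u^k\to u$ and $b^k\to\frac{1}{2\alpha}J$, where $u$ is a solution of the primal problem $$\min_{w\in\mathcal{H}_0(V)}\tfrac12\sum_{i,j}a_{ij}\,|w_i-w_j+(u_f)_i-(u_f)_j|$$ and $J$ gives a solution $-\tfrac12J$ of its dual problem $$\sup\{-\langle b,Du_f\rangle_{\mathcal{H}(E)}:\ b\in\mathcal{H}(E),\ |b_{ij}|\le\tfrac12a_{ij}\ \text{for all } i,j,\ (\mathrm{div}\,b)_i=0\ \text{for all } i\in\mathrm{int}(V)\}.$$ In addition $d^k\to Du$. In particular, $v:=u+u_f$ is a voltage potential corresponding to the data $(f,a)$, i.e. $v\in\mathcal{V}_{(f,a)}$, and $J$ is the induced current, with $|J|=a$, i.e. $|J_{ij}|=a_{ij}$ for all $i,j$.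
   Context: $G=(V,E)$ is a simple, undirected, connected graph with $V=\{1,\dots,n\}$; $\partial V\subset V$ is a nonempty set of boundary vertices, $\mathrm{int}(V)=V\setminus\partial V$, and $f:\partial V\to\mathbb{R}$. A measurement matrix is a symmetric $n\times n$ matrix $a=(a_{ij})$ with $a_{ij}\in[0,\infty)$ and $a_{ij}=0$ if $i=j$ or $\{i,j\}\notin E$; $a$ is a fixed measurement matrix. $\mathcal{H}(V)=\mathbb{R}^n$ is the space of real functions on $V$; $\mathcal{H}_0(V)$ is the subspace of functions vanishing on $\partial V$; $\mathcal{H}(E)$ is the space of real $n\times n$ matrices $b$ with $b_{ij}=0$ if $i=j$ or $\{i,j\}\notin E$, with $\langle b,d\rangle_{\mathcal{H}(E)}=\sum_{i,j}b_{ij}d_{ij}$. For $u\in\mathcal{H}(V)$, $(Du)_{ij}=u_i-u_j$ if $\{i,j\}\in E$ and $0$ otherwise. For $b\in\mathcal{H}(E)$, $(\mathrm{div}\,b)_i=\sum_j(b_{ji}-b_{ij})$. Algorithm 1: let $\alpha>0$, let $u_f\in\mathcal{H}(V)$ with $u_f=f$ on $\partial V$, and initialize $b^0,d^0\in\mathcal{H}(E)$. For $k\ge0$: (1) solve $\sum_j(Du^{k+1})_{ij}=\frac12[(\mathrm{div}\,b^k)_i-(\mathrm{div}\,d^k)_i]$ for all $i\in\mathrm{int}(V)$, with $u^{k+1}_i=0$ for all $i\in\partial V$ (this system is uniquely solvable); (2) with $w_{ij}=(Du^{k+1})_{ij}+(Du_f)_{ij}+b^k_{ij}$, set $d^{k+1}_{ij}=\max\{|w_{ij}|-\frac{a_{ij}}{2\alpha},0\}\frac{w_{ij}}{|w_{ij}|}-(Du_f)_{ij}$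 if $w_{ij}\neq0$ and $d^{k+1}_{ij}=-(Du_f)_{ij}$ if $w_{ij}=0$; (3) set $b^{k+1}_{ij}=b^k_{ij}+(Du^{k+1})_{ij}-d^{k+1}_{ij}$. A current is a real $n\times n$ matrix $K=(K_{ij})$ with $K_{ij}=-K_{ji}$, $K_{ii}=0$, and $K_{ij}=0$ whenever $\{i,j\}\notin E$. The set $\mathcal{V}_{(f,a)}$ of voltage potentials corresponding to $(f,a)$ consists of all $v\in\mathbb{R}^n$ with $v|_{\partial V}=f$ for which there exist a symmetric matrix $\sigma=(\sigma_{ij})$ with $\sigma_{ij}\in[0,\infty]$ and a current $K$ such that $K_{ij}=\sigma_{ij}(v_i-v_j)$ and $|K_{ij}|=a_{ij}$ for all $i,j$ with $v_i\neq v_j$, and $\sum_{j}K_{ij}=0$ for all $i\in\mathrm{int}(V)$; when $a_{ij}\neq0$ and $v_i=v_j$ one formally sets $\sigma_{ij}=\infty$ (perfect conductor). Such a $K$ is called an induced current corresponding to $v$.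
   Formalization: As stated the last clause fails (e.g. f=0, b^0=d^0=0 gives J=0; a symmetric b^0 can give a J that is not a current): |J_ij|=a_ij is claimed only where v_i≠v_j, and J is claimed to be the induced current only when b^0 is antisymmetric. *)

theory Defs
  imports "HOL-Analysis.Analysis"
begin

text \<open>The vertex set is the finite type \<open>'n\<close>; a graph is given by its set \<open>E\<close> of edges, which
  are two-element vertex sets; \<open>B\<close> is the set of boundary vertices. \<open>(b $ i) $ j\<close> is the
  entry \<open>(i, j)\<close> of a matrix, and \<open>\<bullet>\<close> on matrices is the entrywise inner product.\<close>

definition simple_graph :: "'n::finite set set \<Rightarrow> bool" where
  "simple_graph E \<longleftrightarrow> (\<forall>e\<in>E. card e = 2)"

definition connected_graph :: "'n::finite set set \<Rightarrow> bool" where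
  "connected_graph E \<longleftrightarrow> (\<forall>i j. (i, j) \<in> {(x, y). {x, y} \<in> E}\<^sup>*)"

definition H0 :: "'n::finite set \<Rightarrow> (real^'n) set" where
  "H0 B = {u. \<forall>i\<in>B. u $ i = 0}"

definition HE :: "'n::finite set set \<Rightarrow> (real^'n^'n) set" where
  "HE E = {b. \<forall>i j. i = j \<or> {i, j} \<notin> E \<longrightarrow> b $ i $ j = 0}"

definition grad :: "'n::finite set set \<Rightarrow> real^'n \<Rightarrow> real^'n^'n" where
  "grad E u = (\<chi> i j. if {i, j} \<in> E then u $ i - u $ j else 0)"

definition dvg :: "real^'n^'n \<Rightarrow> real^('n::finite)" where
  "dvg b = (\<chi> i. \<Sum>j\<in>UNIV. b $ j $ i - b $ i $ j)"

definition measurement_matrix :: "'n::finite set set \<Rightarrow> real^'n^'n \<Rightarrow> bool" where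
  "measurement_matrix E a \<longleftrightarrow>
     a \<in> HE E \<and> transpose a = a \<and> (\<forall>i j. 0 \<le> a $ i $ j)"

definition shrink :: "real \<Rightarrow> real \<Rightarrow> real" where
  "shrink t w = (if w = 0 then 0 else max (\<bar>w\<bar> - t) 0 * (w / \<bar>w\<bar>))"

text \<open>\<open>u 0\<close> is not used: the algorithm produces \<open>u\<close> from index 1 on.\<close>

definition split_bregman ::
    "'n::finite set set \<Rightarrow> 'n set \<Rightarrow> real^'n^'n \<Rightarrow> real \<Rightarrow> real^'n
      \<Rightarrow> (nat \<Rightarrow> real^'n) \<Rightarrow> (nat \<Rightarrow> real^'n^'n) \<Rightarrow> (nat \<Rightarrow> real^'n^'n) \<Rightarrow> bool" where
  "split_bregman E B a \<alpha> uf u b d \<longleftrightarrow>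
     b 0 \<in> HE E \<and> d 0 \<in> HE E \<and>
     (\<forall>k.
       (\<forall>i\<in>-B. (\<Sum>j\<in>UNIV. grad E (u (Suc k)) $ i $ j) = (dvg (b k) $ i - dvg (d k) $ i) / 2) \<and>
       (\<forall>i\<in>B. u (Suc k) $ i = 0) \<and>
       (\<forall>i j. d (Suc k) $ i $ j =
          shrink (a $ i $ j / (2 * \<alpha>)) (grad E (u (Suc k)) $ i $ j + grad E uf $ i $ j + b k $ i $ j)
          - grad E uf $ i $ j) \<and>
       (\<forall>i j. b (Suc k) $ i $ j = b k $ i $ j + grad E (u (Suc k)) $ i $ j - d (Suc k) $ i $ j))"

definition primal_objective :: "real^'n^'n \<Rightarrow> real^'n \<Rightarrow> real^'n \<Rightarrow> real" where
  "primal_objective a uf w =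
     1/2 * (\<Sum>i\<in>UNIV. \<Sum>j\<in>UNIV. a $ i $ j * \<bar>w $ i - w $ j + uf $ i - uf $ j\<bar>)"

definition primal_solution :: "'n::finite set \<Rightarrow> real^'n^'n \<Rightarrow> real^'n \<Rightarrow> real^'n \<Rightarrow> bool" where
  "primal_solution B a uf u \<longleftrightarrow> is_arg_min (primal_objective a uf) (\<lambda>w. w \<in> H0 B) u"

definition dual_feasible ::
    "'n::finite set set \<Rightarrow> 'n set \<Rightarrow> real^'n^'n \<Rightarrow> real^'n^'n \<Rightarrow> bool" where
  "dual_feasible E B a b \<longleftrightarrow>
     b \<in> HE E \<and> (\<forall>i j. \<bar>b $ i $ j\<bar> \<le> 1/2 * a $ i $ j) \<and> (\<forall>i\<in>-B. dvg b $ i = 0)"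

definition dual_solution ::
    "'n::finite set set \<Rightarrow> 'n set \<Rightarrow> real^'n^'n \<Rightarrow> real^'n \<Rightarrow> real^'n^'n \<Rightarrow> bool" where
  "dual_solution E B a uf b \<longleftrightarrow>
     is_arg_max (\<lambda>b. - (b \<bullet> grad E uf)) (dual_feasible E B a) b"

definition current :: "'n::finite set set \<Rightarrow> real^'n^'n \<Rightarrow> bool" where
  "current E K \<longleftrightarrow>
     (\<forall>i j. K $ i $ j = - K $ j $ i) \<and> (\<forall>i. K $ i $ i = 0) \<and>
     (\<forall>i j. {i, j} \<notin> E \<longrightarrow> K $ i $ j = 0)"

text \<open>On pairs with \<open>v $ i = v $ j\<close> neither Ohm's law nor \<open>\<bar>K $ i $ j\<bar> = a $ i $ j\<close> is imposed;
  if moreover \<open>a $ i $ j \<noteq> 0\<close>, the edge is a perfect conductor.\<close>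

definition induced_current ::
    "'n::finite set set \<Rightarrow> 'n set \<Rightarrow> real^'n^'n \<Rightarrow> real^'n \<Rightarrow> real^'n^'n \<Rightarrow> bool" where
  "induced_current E B a v K \<longleftrightarrow>
     current E K \<and>
     (\<exists>\<sigma> :: ereal^'n^'n. transpose \<sigma> = \<sigma> \<and> (\<forall>i j. 0 \<le> \<sigma> $ i $ j) \<and>
        (\<forall>i j. v $ i \<noteq> v $ j \<longrightarrow> ereal (K $ i $ j) = \<sigma> $ i $ j * ereal (v $ i - v $ j)) \<and>
        (\<forall>i j. a $ i $ j \<noteq> 0 \<and> v $ i = v $ j \<longrightarrow> \<sigma> $ i $ j = \<infinity>)) \<and>
     (\<forall>i j. v $ i \<noteq> v $ j \<longrightarrow> \<bar>K $ i $ j\<bar> = a $ i $ j) \<and>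
     (\<forall>i\<in>-B. (\<Sum>j\<in>UNIV. K $ i $ j) = 0)"

definition voltage_potentials ::
    "'n::finite set set \<Rightarrow> 'n set \<Rightarrow> ('n \<Rightarrow> real) \<Rightarrow> real^'n^'n \<Rightarrow> (real^'n) set" where
  "voltage_potentials E B f a =
     {v. (\<forall>i\<in>B. v $ i = f i) \<and> (\<exists>K. induced_current E B a v K)}"

end

theory Submission
  imports Defs
begin

text \<open>
  The primal and dual problems are encoded together by saddle points (\<open>saddle_point\<close>): a potential
  \<open>u\<close> vanishing on \<open>B\<close> and a matrix \<open>b\<close>, orthogonal to all gradients of functions vanishing on
  \<open>B\<close>, that is a subgradient at \<open>grad E (u + uf)\<close> of the l1 norm weighted by \<open>t = a / (2 \<alpha>)\<close>.
  Orthogonality says that \<open>b\<close> is divergence free off \<open>B\<close> (summation by parts,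
  \<open>orthogonal_grad_iff\<close>). Where \<open>v = u + uf\<close> differs at the ends of an edge, the subgradient
  condition forces \<open>J = 2 \<alpha> b\<close> to be \<open>a\<close> times the sign of the voltage drop; this is Ohm's law with
  \<open>\<bar>J\<bar> = a\<close> there. Hence the claims about the limits are properties of saddle points, except that
  \<open>J\<close> itself is a current only if it is antisymmetric, which it inherits from \<open>b 0\<close>.

  The iteration converges to a saddle point for the following reason. Optimality in the first step
  makes \<open>grad E (u (k+1)) + b k - d k\<close> orthogonal to the gradients, and the shrinkage in the second step
  makes \<open>b (k+1)\<close> a subgradient at \<open>d (k+1) + grad E uf\<close>. For any saddle point \<open>(u', b')\<close>, expanding
  squares and using that the subdifferential is monotone gives (\<open>split_bregman_fejer\<close>) that the energy
  \<open>\<parallel>b k - b'\<parallel>^2 + \<parallel>d k - grad E u'\<parallel>^2\<close> drops in each step at least by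
  \<open>\<parallel>grad E (u (k+1)) - d k\<parallel>^2\<close>. So \<open>(b, d)\<close> is bounded and these gaps tend to zero. A cluster
  point of \<open>(b, d)\<close> therefore comes from a saddle point, since both optimality conditions are closed.
  Monotonicity of the energy about this particular saddle point upgrades convergence of a subsequence to
  convergence of the whole sequence. Finally \<open>u\<close> converges because the gradient is injective on
  functions vanishing on \<open>B\<close>, the graph being connected and \<open>B\<close> nonempty.

  The argument needs one saddle point to begin with (\<open>saddle_point_exists\<close>). A primal minimiser exists
  because only the weighted gradients matter, and these form a closed affine set on which the l1 norm is
  coercive. The multiplier \<open>b\<close> is a rescaled normal of a hyperplane that separates the affine
  set of gradients from the open sublevel set of the norm at the minimal value.
\<close>

section \<open>Discrete calculus on the graph\<close>

lemma matrix_inner: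
  fixes b e :: "real^'n^'n::finite"
  shows "b \<bullet> e = (\<Sum>i\<in>UNIV. \<Sum>j\<in>UNIV. b $ i $ j * e $ i $ j)"
  by (simp add: inner_vec_def)

lemma linear_grad: "linear (grad E)"
  by (rule linearI) (auto simp: grad_def vec_eq_iff algebra_simps)

lemma subspace_H0: "subspace (H0 B)"
  by (auto simp: subspace_def H0_def)

lemma grad_in_HE: "grad E u \<in> HE E"
  by (auto simp: HE_def grad_def)

lemma dvg_grad: "dvg (grad E u) $ i = - 2 * (\<Sum>j\<in>UNIV. grad E u $ i $ j)"
proof -
  have "grad E u $ j $ i = - grad E u $ i $ j" for j by (simp add: grad_def insert_commute)
  then show ?thesis by (simp add: dvg_def sum_subtractf sum_negf)
qed

text \<open>Summation by parts: on edge matrices, minus the divergence is the adjoint of the gradient.\<close>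

lemma inner_grad:
  assumes "b \<in> HE E"
  shows "b \<bullet> grad E w = - (\<Sum>i\<in>UNIV. dvg b $ i * w $ i)"
proof -
  have "b \<bullet> grad E w = (\<Sum>i\<in>UNIV. \<Sum>j\<in>UNIV. b $ i $ j * (w $ i - w $ j))"
    unfolding matrix_inner using assms
    by (intro sum.cong refl) (auto simp: grad_def HE_def)
  also have "\<dots> = (\<Sum>i\<in>UNIV. \<Sum>j\<in>UNIV. b $ i $ j * w $ i) - (\<Sum>i\<in>UNIV. \<Sum>j\<in>UNIV. b $ i $ j * w $ j)"
    by (simp add: right_diff_distrib sum_subtractf)
  also have "(\<Sum>i\<in>UNIV. \<Sum>j\<in>UNIV. b $ i $ j * w $ j) = (\<Sum>i\<in>UNIV. \<Sum>j\<in>UNIV. b $ j $ i * w $ i)"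
    by (rule sum.swap)
  finally show ?thesis
    by (simp add: dvg_def sum_distrib_right left_diff_distrib sum_subtractf)
qed

text \<open>Kirchhoff's law at the interior vertices, tested against the unit functions of these vertices.\<close>

lemma orthogonal_grad_iff:
  assumes "b \<in> HE E"
  shows "(\<forall>w\<in>H0 B. b \<bullet> grad E w = 0) \<longleftrightarrow> (\<forall>i\<in>-B. dvg b $ i = 0)"
proof
  assume orth: "\<forall>w\<in>H0 B. b \<bullet> grad E w = 0"
  show "\<forall>i\<in>-B. dvg b $ i = 0"
  proof
    fix i assume "i \<in> -B"
    then have "axis i 1 \<in> H0 B" by (auto simp: H0_def axis_def)
    moreover have "b \<bullet> grad E (axis i 1) = - dvg b $ i"
      by (simp add: inner_grad[OF assms] axis_def if_distrib[of "(*) _"] cong: if_cong)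
    ultimately show "dvg b $ i = 0" using orth by force
  qed
next
  assume "\<forall>i\<in>-B. dvg b $ i = 0"
  then show "\<forall>w\<in>H0 B. b \<bullet> grad E w = 0"
    by (auto simp: inner_grad[OF assms] H0_def intro!: sum.neutral)
qed

text \<open>A function with zero gradient is constant along paths, and some boundary vertex pins the
  constant to zero.\<close>

lemma grad_injective_on_H0:
  assumes "connected_graph E" and "B \<noteq> {}" and "u \<in> H0 B" and "grad E u = 0"
  shows "u = 0"
proof -
  obtain i where "i \<in> B" using assms(2) by blast
  then have ui: "u $ i = 0" using assms(3) by (simp add: H0_def)
  have "u $ j = u $ i" if "(i, j) \<in> {(x, y). {x, y} \<in> E}\<^sup>*" for j
    using that
  proof induction
    case (step x y)
    have "grad E u $ x $ y = u $ x - u $ y" using step.hyps by (simp add: grad_def)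
    then show ?case using step.IH assms(4) by simp
  qed simp
  then show ?thesis using assms(1) ui by (simp add: connected_graph_def vec_eq_iff)
qed

section \<open>The weighted l1 norm and its subdifferential\<close>

definition weighted_l1 :: "real^'n^'n \<Rightarrow> real^'n^'n::finite \<Rightarrow> real" where
  "weighted_l1 t e = (\<Sum>i\<in>UNIV. \<Sum>j\<in>UNIV. t $ i $ j * \<bar>e $ i $ j\<bar>)"

text \<open>Membership of \<open>b\<close> in the subdifferential of \<open>weighted_l1 t\<close> at \<open>e\<close>, spelled out entrywise:
  the subdifferential of the absolute value consists of the slopes of modulus at most 1 that attain it.
  This form is evidently closed in \<open>(e, b)\<close>.\<close>

definition l1_subgradient :: "real^'n^'n \<Rightarrow> real^'n^'n::finite \<Rightarrow> real^'n^'n \<Rightarrow> bool" where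
  "l1_subgradient t e b \<longleftrightarrow>
     (\<forall>i j. \<bar>b $ i $ j\<bar> \<le> t $ i $ j \<and> b $ i $ j * e $ i $ j = t $ i $ j * \<bar>e $ i $ j\<bar>)"

lemma mult_le_bound_abs:
  fixes b t e :: real
  assumes "\<bar>b\<bar> \<le> t"
  shows "b * e \<le> t * \<bar>e\<bar>"
  using mult_right_mono[OF assms abs_ge_zero[of e]] abs_ge_self[of "b * e"] by (simp add: abs_mult)

lemma inner_le_weighted_l1:
  assumes "\<And>i j. \<bar>b $ i $ j\<bar> \<le> t $ i $ j"
  shows "b \<bullet> e \<le> weighted_l1 t e"
  unfolding matrix_inner weighted_l1_def by (intro sum_mono mult_le_bound_abs assms)

text \<open>Equality in the Hoelder-type bound \<open>inner_le_weighted_l1\<close> can only hold entry by entry, so the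
  single inequality between the totals suffices.\<close>

lemma l1_subgradient_iff:
  "l1_subgradient t e b \<longleftrightarrow> (\<forall>i j. \<bar>b $ i $ j\<bar> \<le> t $ i $ j) \<and> weighted_l1 t e \<le> b \<bullet> e"
proof
  assume "l1_subgradient t e b"
  then show "(\<forall>i j. \<bar>b $ i $ j\<bar> \<le> t $ i $ j) \<and> weighted_l1 t e \<le> b \<bullet> e"
    by (simp add: l1_subgradient_def matrix_inner weighted_l1_def)
next
  assume *: "(\<forall>i j. \<bar>b $ i $ j\<bar> \<le> t $ i $ j) \<and> weighted_l1 t e \<le> b \<bullet> e"
  then have le: "b $ i $ j * e $ i $ j \<le> t $ i $ j * \<bar>e $ i $ j\<bar>" for i j
    by (simp add: mult_le_bound_abs)
  have "(\<Sum>i\<in>UNIV. \<Sum>j\<in>UNIV. t $ i $ j * \<bar>e $ i $ j\<bar> - b $ i $ j * e $ i $ j) \<le> 0"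
    using * by (simp add: sum_subtractf matrix_inner weighted_l1_def)
  then have "(\<Sum>i\<in>UNIV. \<Sum>j\<in>UNIV. t $ i $ j * \<bar>e $ i $ j\<bar> - b $ i $ j * e $ i $ j) = 0"
    using le by (intro antisym sum_nonneg) simp_all
  then have "t $ i $ j * \<bar>e $ i $ j\<bar> - b $ i $ j * e $ i $ j = 0" for i j
    using le by (simp add: sum_nonneg_eq_0_iff sum_nonneg)
  then show "l1_subgradient t e b" using * by (simp add: l1_subgradient_def)
qed

lemma l1_subgradient_inner:
  assumes "l1_subgradient t e b"
  shows "b \<bullet> e = weighted_l1 t e"
  using assms by (simp add: l1_subgradient_def matrix_inner weighted_l1_def)

lemma l1_subgradient_monotone:
  assumes "l1_subgradient t e b" and "l1_subgradient t e' b'"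
  shows "0 \<le> (b - b') \<bullet> (e - e')"
proof -
  have "b \<bullet> e' \<le> weighted_l1 t e'" "b' \<bullet> e \<le> weighted_l1 t e"
    using assms by (auto intro: inner_le_weighted_l1 simp: l1_subgradient_def)
  then show ?thesis
    using l1_subgradient_inner[OF assms(1)] l1_subgradient_inner[OF assms(2)]
    by (simp add: inner_diff_left inner_diff_right)
qed

lemma l1_subgradient_limit:
  assumes "\<And>k::nat. l1_subgradient t (e k) (b k)"
    and "e \<longlonglongrightarrow> e'" and "b \<longlonglongrightarrow> b'"
  shows "l1_subgradient t e' b'"
  unfolding l1_subgradient_def
proof (intro allI conjI)
  fix i j
  have be: "(\<lambda>k. b k $ i $ j) \<longlonglongrightarrow> b' $ i $ j" "(\<lambda>k. e k $ i $ j) \<longlonglongrightarrow> e' $ i $ j"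
    using assms by (auto intro!: tendsto_intros)
  have sub: "\<bar>b k $ i $ j\<bar> \<le> t $ i $ j" "b k $ i $ j * e k $ i $ j = t $ i $ j * \<bar>e k $ i $ j\<bar>" for k
    using assms(1)[of k] by (auto simp: l1_subgradient_def)
  show "\<bar>b' $ i $ j\<bar> \<le> t $ i $ j"
    by (rule LIMSEQ_le_const2[OF tendsto_rabs[OF be(1)]]) (auto simp: sub)
  have "(\<lambda>k. b k $ i $ j * e k $ i $ j) \<longlonglongrightarrow> t $ i $ j * \<bar>e' $ i $ j\<bar>"
    unfolding sub(2) by (intro tendsto_intros be)
  then show "b' $ i $ j * e' $ i $ j = t $ i $ j * \<bar>e' $ i $ j\<bar>"
    using tendsto_mult[OF be] LIMSEQ_unique by blast
qed

text \<open>Shrinkage is the proximal map of \<open>t\<close> times the absolute value, so what it cuts off from \<open>w\<close> is a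
  subgradient at the result. This is what makes every \<open>b (k+1)\<close> dual feasible in size.\<close>

lemma shrink_residual:
  assumes "0 \<le> t"
  shows "\<bar>w - shrink t w\<bar> \<le> t" and "(w - shrink t w) * shrink t w = t * \<bar>shrink t w\<bar>"
proof -
  consider "\<bar>w\<bar> \<le> t" | "w > t" | "w < - t" by linarith
  then have "\<bar>w - shrink t w\<bar> \<le> t \<and> (w - shrink t w) * shrink t w = t * \<bar>shrink t w\<bar>"
  proof cases
    case 1
    then have "shrink t w = 0" by (simp add: shrink_def)
    then show ?thesis using 1 by simp
  next
    case 2
    then have "shrink t w = w - t" using assms by (simp add: shrink_def)
    then show ?thesis using assms 2 by simp
  next
    case 3
    then have "shrink t w = w + t" using assms by (simp add: shrink_def)
    then show ?thesis using assms 3 by (simp add: algebra_simps)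
  qed
  then show "\<bar>w - shrink t w\<bar> \<le> t" and "(w - shrink t w) * shrink t w = t * \<bar>shrink t w\<bar>"
    by auto
qed

lemma shrink_minus: "shrink t (- w) = - shrink t w"
  by (simp add: shrink_def)

section \<open>Saddle points\<close>

definition saddle_point ::
    "'n::finite set set \<Rightarrow> 'n set \<Rightarrow> real^'n^'n \<Rightarrow> real^'n \<Rightarrow> real^'n \<Rightarrow> real^'n^'n \<Rightarrow> bool" where
  "saddle_point E B t uf u b \<longleftrightarrow>
     u \<in> H0 B \<and> (\<forall>w\<in>H0 B. b \<bullet> grad E w = 0) \<and> l1_subgradient t (grad E (u + uf)) b"

text \<open>The set to be separated from the gradients when the multiplier is constructed.\<close>

lemma convex_weighted_l1_less:
  fixes t :: "real^'n^'n::finite"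
  assumes "\<And>i j. 0 \<le> t $ i $ j"
  shows "convex {e. weighted_l1 t e < p}"
proof (rule convexI)
  fix x y :: "real^'n^'n" and r s :: real
  assume x: "x \<in> {e. weighted_l1 t e < p}" and y: "y \<in> {e. weighted_l1 t e < p}"
    and rs: "0 \<le> r" "0 \<le> s" "r + s = 1"
  have "weighted_l1 t (r *\<^sub>R x + s *\<^sub>R y) \<le> r * weighted_l1 t x + s * weighted_l1 t y"
    unfolding weighted_l1_def sum_distrib_left sum.distrib[symmetric]
  proof (intro sum_mono)
    fix i j
    have "\<bar>r * x $ i $ j + s * y $ i $ j\<bar> \<le> r * \<bar>x $ i $ j\<bar> + s * \<bar>y $ i $ j\<bar>"
      using rs abs_triangle_ineq[of "r * x $ i $ j" "s * y $ i $ j"] by (simp add: abs_mult)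
    from mult_left_mono[OF this assms[of i j]]
    show "t $ i $ j * \<bar>(r *\<^sub>R x + s *\<^sub>R y) $ i $ j\<bar>
        \<le> r * (t $ i $ j * \<bar>x $ i $ j\<bar>) + s * (t $ i $ j * \<bar>y $ i $ j\<bar>)"
      by (simp add: algebra_simps)
  qed
  also have "\<dots> < p"
    using convex_bound_lt[of "weighted_l1 t x" p "weighted_l1 t y" r s] x y rs by simp
  finally show "r *\<^sub>R x + s *\<^sub>R y \<in> {e. weighted_l1 t e < p}" by simp
qed

text \<open>Weights may vanish, so \<open>weighted_l1 t\<close> need not be coercive in the gradient or in the
  potential. The minimum is therefore sought among the matrices \<open>t \<cdot> grad (w + uf)\<close>, multiplied
  entrywise: they form an affine subspace, which is closed, and there the value is the unweighted l1
  norm, which dominates the Euclidean norm.\<close>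

lemma weighted_l1_attains_min:
  fixes t :: "real^'n::finite^'n" and uf :: "real^'n"
  assumes "\<And>i j. 0 \<le> t $ i $ j"
  obtains u where "u \<in> H0 B"
    and "\<And>w. w \<in> H0 B \<Longrightarrow> weighted_l1 t (grad E (u + uf)) \<le> weighted_l1 t (grad E (w + uf))"
proof -
  define m where "m e = (\<chi> i j. t $ i $ j * e $ i $ j)" for e :: "real^'n^'n"
  define N where "N x = (\<Sum>i\<in>UNIV. \<Sum>j\<in>UNIV. \<bar>x $ i $ j\<bar>)" for x :: "real^'n^'n"
  have N_m: "N (m e) = weighted_l1 t e" for e
    using assms by (simp add: N_def m_def weighted_l1_def abs_mult)
  have lin: "linear (\<lambda>w. m (grad E w))"
    by (rule linearI) (auto simp: m_def grad_def vec_eq_iff algebra_simps)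
  define S where "S = (+) (m (grad E uf)) ` (\<lambda>w. m (grad E w)) ` H0 B"
  have S_eq: "S = (\<lambda>w. m (grad E (w + uf))) ` H0 B"
    unfolding S_def image_image linear_add[OF lin] by (simp add: add.commute)
  have "closed S"
    unfolding S_def
    by (intro closed_translation closed_subspace linear_subspace_image[OF lin subspace_H0])
  have norm_le: "norm x \<le> N x" for x
  proof -
    have "norm x \<le> (\<Sum>i\<in>UNIV. norm (x $ i))"
      unfolding norm_vec_def by (rule L2_set_le_sum) simp
    also have "\<dots> \<le> N x"
      unfolding N_def by (intro sum_mono norm_le_l1_cart)
    finally show ?thesis .
  qed
  have cont: "continuous_on A N" for A
    unfolding N_def by (intro continuous_intros)
  define s where "s = m (grad E uf)"
  have sS: "s \<in> S"
    unfolding S_eq s_def by (rule image_eqI[of _ _ 0]) (simp_all add: H0_def)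
  have "compact (S \<inter> cball 0 (N s))"
    using \<open>closed S\<close> by (intro closed_Int_compact) auto
  moreover have "s \<in> S \<inter> cball 0 (N s)"
    using sS norm_le by simp
  ultimately obtain x where x: "x \<in> S" "\<And>y. y \<in> S \<inter> cball 0 (N s) \<Longrightarrow> N x \<le> N y"
    using continuous_attains_inf[OF _ _ cont] by (metis IntD1 empty_iff)
  have min: "N x \<le> N y" if "y \<in> S" for y
  proof (cases "N y \<le> N s")
    case True
    then show ?thesis using that norm_le[of y] by (intro x) simp
  next
    case False
    then show ?thesis using x(2)[of s] sS norm_le[of s] by simp
  qed
  obtain u where u: "u \<in> H0 B" "x = m (grad E (u + uf))"
    using x(1) unfolding S_eq by blast
  have "weighted_l1 t (grad E (u + uf)) \<le> weighted_l1 t (grad E (w + uf))" if "w \<in> H0 B" for w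
    using min[of "m (grad E (w + uf))"] that u(2) unfolding S_eq N_m[symmetric] by simp
  with u(1) show ?thesis by (rule that)
qed

text \<open>Strong duality. Let \<open>p\<close> be the minimum and let \<open>q\<close> and \<open>c\<close> describe a hyperplane between the
  sublevel set \<open>C\<close> of \<open>p\<close> and the affine set \<open>S\<close> of gradients. Being bounded below on \<open>S\<close> forces
  \<open>q\<close> to be orthogonal to the directions of \<open>S\<close>; being bounded by \<open>c\<close> on \<open>C\<close> bounds the entries
  of \<open>q\<close> by \<open>c / p\<close> times the weights. Hence \<open>(p / c) q\<close> is the multiplier.\<close>

lemma saddle_point_exists:
  fixes t :: "real^'n::finite^'n"
  assumes t: "\<And>i j. 0 \<le> t $ i $ j"
  obtains u b where "saddle_point E B t uf u b"
proof -
  obtain u where u: "u \<in> H0 B"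
    and min: "\<And>w. w \<in> H0 B \<Longrightarrow> weighted_l1 t (grad E (u + uf)) \<le> weighted_l1 t (grad E (w + uf))"
    using weighted_l1_attains_min[OF t] by blast
  define p where "p = weighted_l1 t (grad E (u + uf))"
  have "p \<ge> 0" using t by (auto simp: p_def weighted_l1_def intro!: sum_nonneg)
  then consider "p = 0" | "p > 0" by linarith
  then show ?thesis
  proof cases
    \<comment> \<open>The open sublevel set is empty if the minimum is zero, but then zero is a multiplier.\<close>
    case 1
    then have "l1_subgradient t (grad E (u + uf)) 0"
      using t by (simp add: l1_subgradient_iff p_def)
    then have "saddle_point E B t uf u 0"
      using u by (simp add: saddle_point_def)
    then show ?thesis by (rule that)
  next
    case 2
    define C where "C = {e. weighted_l1 t e < p}"
    define S where "S = (+) (grad E uf) ` grad E ` H0 B"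
    have S_eq: "S = (\<lambda>w. grad E (w + uf)) ` H0 B"
      unfolding S_def image_image linear_add[OF linear_grad] by (simp add: add.commute)
    have "convex C" unfolding C_def by (rule convex_weighted_l1_less[OF t])
    moreover have "convex S"
      unfolding S_def
      by (intro convex_translation subspace_imp_convex linear_subspace_image linear_grad subspace_H0)
    moreover have C0: "0 \<in> C" using 2 by (simp add: C_def weighted_l1_def)
    moreover have "S \<noteq> {}" using u by (auto simp: S_def)
    moreover have "C \<inter> S = {}"
    proof -
      have "\<not> weighted_l1 t (grad E (w + uf)) < p" if "w \<in> H0 B" for w
        using min[OF that] by (simp add: p_def)
      then show ?thesis unfolding C_def S_eq by blast
    qed
    ultimately obtain q c where "q \<noteq> 0"
      and qC: "\<And>e. e \<in> C \<Longrightarrow> q \<bullet> e \<le> c" and qS: "\<And>e. e \<in> S \<Longrightarrow> c \<le> q \<bullet> e"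
      using separating_hyperplane_sets[of C S] by blast
    have "c \<ge> 0" using qC[OF C0] by simp
    have bound: "\<bar>q $ i $ j\<bar> * p \<le> c * t $ i $ j" for i j
    proof (rule ccontr)
      assume neg: "\<not> ?thesis"
      then have q: "\<bar>q $ i $ j\<bar> > 0"
        using mult_nonneg_nonneg[OF \<open>c \<ge> 0\<close> t[of i j]] by (cases "q $ i $ j = 0") auto
      \<comment> \<open>A multiple \<open>r\<close> of a unit matrix that stays in \<open>C\<close> but lies beyond the hyperplane.\<close>
      obtain r where r: "r * t $ i $ j < p" "c < r * \<bar>q $ i $ j\<bar>"
      proof (cases "t $ i $ j = 0")
        case True
        show ?thesis
          by (rule that[of "(c + 1) / \<bar>q $ i $ j\<bar>"]) (use True 2 q in auto)
      next
        case False
        then have tp: "t $ i $ j > 0" using t[of i j] by simp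
        then have "c / \<bar>q $ i $ j\<bar> < p / t $ i $ j"
          using neg q by (simp add: field_simps)
        then obtain r where "c / \<bar>q $ i $ j\<bar> < r" "r < p / t $ i $ j"
          using dense by blast
        then show ?thesis using that[of r] tp q by (simp add: field_simps)
      qed
      have "r > 0" using r(2) \<open>c \<ge> 0\<close> q by (metis order_le_less_trans zero_less_mult_pos2)
      define e where "e = axis i (axis j (r * sgn (q $ i $ j)))"
      have ax: "(\<Sum>k\<in>UNIV. \<Sum>l\<in>UNIV. F k l (e $ k $ l)) = F i j (r * sgn (q $ i $ j))"
        if "\<And>k l. F k l 0 = 0" for F :: "'n \<Rightarrow> 'n \<Rightarrow> real \<Rightarrow> real"
      proof -
        have "(\<Sum>l\<in>UNIV. F k l (e $ k $ l)) = (if k = i then F i j (r * sgn (q $ i $ j)) else 0)" for k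
        proof (cases "k = i")
          case True
          have "(\<Sum>l\<in>UNIV. F k l (e $ k $ l)) = (\<Sum>l\<in>UNIV. if l = j then F i j (r * sgn (q $ i $ j)) else 0)"
            using True that by (intro sum.cong) (auto simp: e_def axis_def)
          then show ?thesis using True by simp
        qed (simp add: e_def axis_def that)
        then show ?thesis by simp
      qed
      have "weighted_l1 t e = t $ i $ j * \<bar>r * sgn (q $ i $ j)\<bar>"
        unfolding weighted_l1_def by (rule ax) simp
      also have "\<dots> = r * t $ i $ j"
        using q \<open>r > 0\<close> by (simp add: abs_mult abs_sgn_eq)
      finally have "e \<in> C" using r(1) by (simp add: C_def)
      have "q \<bullet> e = q $ i $ j * (r * sgn (q $ i $ j))"
        unfolding matrix_inner by (rule ax) simp
      also have "\<dots> = r * \<bar>q $ i $ j\<bar>"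
        by (simp add: abs_sgn mult_ac)
      finally show False using qC[OF \<open>e \<in> C\<close>] r(2) by simp
    qed
    have "c > 0"
    proof -
      obtain i j where "q $ i $ j \<noteq> 0" using \<open>q \<noteq> 0\<close> by (auto simp: vec_eq_iff)
      then have "0 < \<bar>q $ i $ j\<bar> * p" using 2 by simp
      also note bound
      finally show ?thesis using \<open>c \<ge> 0\<close> by (cases "c = 0") auto
    qed
    have orth: "q \<bullet> grad E w = 0" if w: "w \<in> H0 B" for w
    proof (rule ccontr)
      assume nz: "q \<bullet> grad E w \<noteq> 0"
      \<comment> \<open>Along the line in direction \<open>w\<close>, this is the point where \<open>q\<close> takes the value \<open>c - 1\<close>.\<close>
      define s where "s = (c - 1 - q \<bullet> grad E uf) / (q \<bullet> grad E w)"
      have "grad E uf + grad E (s *\<^sub>R w) \<in> S"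
        unfolding S_def using subspace_scale[OF subspace_H0 w] by blast
      from qS[OF this] have "c \<le> q \<bullet> grad E uf + s * (q \<bullet> grad E w)"
        by (simp add: inner_add_right linear_scale[OF linear_grad])
      then show False using nz by (simp add: s_def)
    qed
    define b where "b = (p / c) *\<^sub>R q"
    have "\<bar>b $ i $ j\<bar> \<le> t $ i $ j" for i j
      using bound[of i j] \<open>c > 0\<close> 2 by (simp add: b_def abs_mult field_simps)
    moreover have "weighted_l1 t (grad E (u + uf)) \<le> b \<bullet> grad E (u + uf)"
    proof -
      have "c \<le> q \<bullet> grad E (u + uf)" using u by (intro qS) (simp add: S_eq)
      then have "p * c \<le> p * (q \<bullet> grad E (u + uf))" using 2 by simp
      then show ?thesis using \<open>c > 0\<close> by (simp add: b_def p_def[symmetric] field_simps)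
    qed
    ultimately have "saddle_point E B t uf u b"
      using u orth by (simp add: saddle_point_def l1_subgradient_iff b_def)
    then show ?thesis by (rule that)
  qed
qed

section \<open>Convergence of the iteration\<close>

text \<open>The algebraic core of the convergence proof, in terms of the deviations from a saddle point:
  \<open>x\<close> is the deviation of the new gradient, and \<open>b\<close>, \<open>d\<close> and \<open>b'\<close>, \<open>d'\<close> are those of the old and the new
  iterates. Squaring \<open>b' + d' = b + x\<close> and inserting the orthogonality gives the identity.\<close>

lemma energy_identity:
  fixes x b d b' d' :: "'a::real_inner"
  assumes "(x + b - d) \<bullet> x = 0" and "b' = b + x - d'"
  shows "(norm b')\<^sup>2 + (norm d')\<^sup>2 + 2 * (b' \<bullet> d') + (norm (x - d))\<^sup>2 = (norm b)\<^sup>2 + (norm d)\<^sup>2"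
  using assms(1) unfolding assms(2) power2_norm_eq_inner
  by (simp add: inner_add_left inner_add_right inner_diff_left inner_diff_right inner_commute)

lemma split_bregman_HE:
  assumes "split_bregman E B a \<alpha> uf u b d" and "measurement_matrix E a"
  shows "b k \<in> HE E \<and> d k \<in> HE E"
proof (induction k)
  case 0
  then show ?case using assms(1) by (simp add: split_bregman_def)
next
  case (Suc k)
  have d: "d (Suc k) $ i $ j = 0" if "i = j \<or> {i, j} \<notin> E" for i j
    using assms Suc that
    by (auto simp: split_bregman_def HE_def grad_def shrink_def)
  have "b (Suc k) $ i $ j = 0" if "i = j \<or> {i, j} \<notin> E" for i j
    using assms Suc that d[OF that]
    by (auto simp: split_bregman_def HE_def grad_def)
  with d show ?case by (auto simp: HE_def)
qed

text \<open>The linear system of the first step consists of the normal equations for projecting \<open>d k - b k\<close>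
  onto the gradients of functions vanishing on the boundary.\<close>

lemma split_bregman_u_step:
  assumes "split_bregman E B a \<alpha> uf u b d" and "measurement_matrix E a" and "w \<in> H0 B"
  shows "(grad E (u (Suc k)) + b k - d k) \<bullet> grad E w = 0"
proof -
  let ?r = "grad E (u (Suc k)) + b k - d k"
  have "?r \<in> HE E"
    using split_bregman_HE[OF assms(1,2), of k] grad_in_HE[of E "u (Suc k)"] by (auto simp: HE_def)
  moreover have "dvg ?r $ i = 0" if "i \<in> -B" for i
  proof -
    have "dvg ?r $ i = dvg (grad E (u (Suc k))) $ i + dvg (b k) $ i - dvg (d k) $ i"
      by (simp add: dvg_def sum_subtractf sum.distrib)
    also have "\<dots> = 0"
    proof -
      have "(\<Sum>j\<in>UNIV. grad E (u (Suc k)) $ i $ j) = (dvg (b k) $ i - dvg (d k) $ i) / 2"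
        using assms(1) that unfolding split_bregman_def by blast
      then show ?thesis unfolding dvg_grad by (simp add: field_simps)
    qed
    finally show ?thesis .
  qed
  ultimately show ?thesis using orthogonal_grad_iff assms(3) by blast
qed

lemma split_bregman_d_step:
  assumes "split_bregman E B a \<alpha> uf u b d" and "measurement_matrix E a" and "\<alpha> > 0"
  shows "l1_subgradient ((1 / (2 * \<alpha>)) *\<^sub>R a) (d (Suc k) + grad E uf) (b (Suc k))"
  unfolding l1_subgradient_def
proof (intro allI)
  fix i j
  define w where "w = grad E (u (Suc k)) $ i $ j + grad E uf $ i $ j + b k $ i $ j"
  define s where "s = a $ i $ j / (2 * \<alpha>)"
  have s: "0 \<le> s" "((1 / (2 * \<alpha>)) *\<^sub>R a) $ i $ j = s"
    using assms by (auto simp: s_def measurement_matrix_def)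
  have d: "(d (Suc k) + grad E uf) $ i $ j = shrink s w"
    using assms(1) by (simp add: split_bregman_def s_def w_def)
  have "b (Suc k) $ i $ j = b k $ i $ j + grad E (u (Suc k)) $ i $ j - d (Suc k) $ i $ j"
    using assms(1) by (simp add: split_bregman_def)
  then have "b (Suc k) $ i $ j = w - shrink s w"
    unfolding d[symmetric] by (simp add: w_def)
  then show "\<bar>b (Suc k) $ i $ j\<bar> \<le> ((1 / (2 * \<alpha>)) *\<^sub>R a) $ i $ j \<and>
      b (Suc k) $ i $ j * (d (Suc k) + grad E uf) $ i $ j
      = ((1 / (2 * \<alpha>)) *\<^sub>R a) $ i $ j * \<bar>(d (Suc k) + grad E uf) $ i $ j\<bar>"
    unfolding s d using shrink_residual[OF s(1)] by simp
qed

text \<open>Both \<open>(b k, d k)\<close> and the saddle point satisfy the same two optimality conditions, so the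
  differences satisfy the orthogonality of \<open>energy_identity\<close>, and monotonicity of the subdifferential
  makes the mixed term nonnegative. Monotonicity applies to the new iterates only: the initial
  \<open>b 0\<close> is not a subgradient in general.\<close>

lemma split_bregman_fejer:
  assumes sb: "split_bregman E B a \<alpha> uf u b d" and a: "measurement_matrix E a" and \<alpha>: "\<alpha> > 0"
    and saddle: "saddle_point E B ((1 / (2 * \<alpha>)) *\<^sub>R a) uf us bs"
  shows "(dist (b (Suc k), d (Suc k)) (bs, grad E us))\<^sup>2 + (norm (grad E (u (Suc k)) - d k))\<^sup>2
    \<le> (dist (b k, d k) (bs, grad E us))\<^sup>2"
proof -
  note diff = linear_diff[OF linear_grad] and add = linear_add[OF linear_grad]
  have "u (Suc k) \<in> H0 B" using sb by (simp add: split_bregman_def H0_def)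
  then have w: "u (Suc k) - us \<in> H0 B"
    using saddle subspace_diff[OF subspace_H0] by (auto simp: saddle_point_def)
  let ?x = "grad E (u (Suc k) - us)"
  have "bs \<bullet> ?x = 0" using saddle w by (simp add: saddle_point_def)
  then have orth: "(?x + (b k - bs) - (d k - grad E us)) \<bullet> ?x = 0"
    using split_bregman_u_step[OF sb a w, of k]
    by (simp add: diff inner_diff_left inner_add_left)
  have "b (Suc k) = b k + grad E (u (Suc k)) - d (Suc k)"
    using sb by (simp add: split_bregman_def vec_eq_iff)
  then have upd: "b (Suc k) - bs = (b k - bs) + ?x - (d (Suc k) - grad E us)"
    by (simp add: diff)
  have "0 \<le> (b (Suc k) - bs) \<bullet> (d (Suc k) - grad E us)"
    using l1_subgradient_monotone[OF split_bregman_d_step[OF sb a \<alpha>], of _ bs k] saddle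
    by (fastforce simp: saddle_point_def add)
  then show ?thesis
    using energy_identity[OF orth upd] by (simp add: dist_norm norm_Pair diff)
qed

text \<open>The energy about an arbitrary saddle point yields boundedness and vanishing gaps, hence a cluster
  point \<open>(bl, dl)\<close>; once this is known to come from a saddle point, the energy about it is
  decreasing and tends to zero along a subsequence, hence tends to zero.\<close>

lemma split_bregman_converges:
  fixes E :: "'n::finite set set"
  assumes conn: "connected_graph E" and "B \<noteq> {}"
    and a: "measurement_matrix E a" and \<alpha>: "\<alpha> > 0" and sb: "split_bregman E B a \<alpha> uf u b d"
  obtains ul bl where "saddle_point E B ((1 / (2 * \<alpha>)) *\<^sub>R a) uf ul bl"
    and "u \<longlonglongrightarrow> ul" and "b \<longlonglongrightarrow> bl" and "d \<longlonglongrightarrow> grad E ul"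
proof -
  let ?t = "(1 / (2 * \<alpha>)) *\<^sub>R a"
  let ?z = "\<lambda>k. (b k, d k)"
  let ?V = "\<lambda>us bs k. (dist (?z k) (bs, grad E us))\<^sup>2"
  have blin: "bounded_linear (grad E)"
    using linear_grad by (rule linear_conv_bounded_linear[THEN iffD1])
  have dec: "decseq (?V us bs)" if "saddle_point E B ?t uf us bs" for us bs
    using split_bregman_fejer[OF sb a \<alpha> that] by (intro decseq_SucI) (smt (verit) zero_le_power2)
  have Vconv: "\<exists>L. ?V us bs \<longlonglongrightarrow> L" if "saddle_point E B ?t uf us bs" for us bs
    using decseq_convergent[OF dec[OF that], of 0] by auto
  have "0 \<le> ?t $ i $ j" for i j
    using a \<alpha> by (simp add: measurement_matrix_def)
  then obtain us bs where s: "saddle_point E B ?t uf us bs"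
    using saddle_point_exists[of ?t E B uf] by blast
  have gap: "(\<lambda>k. grad E (u (Suc k)) - d k) \<longlonglongrightarrow> 0"
  proof -
    obtain L where L: "?V us bs \<longlonglongrightarrow> L" using Vconv[OF s] by blast
    have diff: "(\<lambda>k. ?V us bs k - ?V us bs (Suc k)) \<longlonglongrightarrow> L - L"
      by (intro tendsto_diff L LIMSEQ_Suc)
    have "(\<lambda>k. (norm (grad E (u (Suc k)) - d k))\<^sup>2) \<longlonglongrightarrow> 0"
    proof (rule Lim_null_comparison[rotated])
      show "(\<lambda>k. ?V us bs k - ?V us bs (Suc k)) \<longlonglongrightarrow> 0"
        using diff by (simp only: diff_self)
      have "norm ((norm (grad E (u (Suc k)) - d k))\<^sup>2) \<le> ?V us bs k - ?V us bs (Suc k)" for k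
        using split_bregman_fejer[OF sb a \<alpha> s, of k] unfolding real_norm_def abs_power2 by linarith
      then show "\<forall>\<^sub>F k in sequentially.
          norm ((norm (grad E (u (Suc k)) - d k))\<^sup>2) \<le> ?V us bs k - ?V us bs (Suc k)"
        by (intro always_eventually allI)
    qed
    then show ?thesis
      by (simp add: tendsto_norm_zero_iff)
  qed
  have "bounded (range ?z)"
  proof (rule boundedI)
    fix z assume "z \<in> range ?z"
    then obtain k where k: "z = ?z k" by blast
    have "?V us bs k \<le> ?V us bs 0" using dec[OF s] by (rule decseqD) simp
    then have "dist (?z k) (bs, grad E us) \<le> dist (?z 0) (bs, grad E us)"
      by simp
    then show "norm z \<le> dist (?z 0) (bs, grad E us) + norm (bs, grad E us)"
      unfolding k using norm_triangle_sub[of "?z k" "(bs, grad E us)"] unfolding dist_norm by linarith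
  qed
  then obtain zl r where r: "strict_mono (r :: nat \<Rightarrow> nat)" and zl: "(?z \<circ> r) \<longlonglongrightarrow> zl"
    using bounded_imp_convergent_subsequence by blast
  obtain bl dl where zl_eq: "zl = (bl, dl)" by (cases zl)
  have br: "(b \<circ> r) \<longlonglongrightarrow> bl" and dr: "(d \<circ> r) \<longlonglongrightarrow> dl"
    using tendsto_fst[OF zl] tendsto_snd[OF zl] by (simp_all add: zl_eq o_def)
  have gap_r: "(\<lambda>k. grad E (u (Suc (r k))) - d (r k)) \<longlonglongrightarrow> 0"
    using LIMSEQ_subseq_LIMSEQ[OF gap r] by (simp add: o_def)
  have uH0: "u (Suc k) \<in> H0 B" for k using sb by (simp add: split_bregman_def H0_def)
  have lim_dl: "(\<lambda>k. grad E (u (Suc (r k)))) \<longlonglongrightarrow> dl"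
    using tendsto_add[OF gap_r dr] by (simp add: o_def)
  \<comment> \<open>As the gaps vanish, gradients converge to \<open>dl\<close>, so \<open>dl\<close> is itself a gradient.\<close>
  have "closed (grad E ` H0 B)"
    by (intro closed_subspace linear_subspace_image linear_grad subspace_H0)
  then have "dl \<in> grad E ` H0 B"
    by (rule closed_sequentially[OF _ _ lim_dl]) (intro imageI uH0)
  then obtain ul where ul: "ul \<in> H0 B" "dl = grad E ul" by blast
  have saddle: "saddle_point E B ?t uf ul bl"
    unfolding saddle_point_def
  proof (intro conjI ballI ul(1))
    fix w assume w: "w \<in> H0 B"
    have "(\<lambda>k. (grad E (u (Suc (r k))) - d (r k) + b (r k)) \<bullet> grad E w) \<longlonglongrightarrow> (0 + bl) \<bullet> grad E w"
      using br by (intro tendsto_intros gap_r) (simp add: o_def)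
    moreover have "(grad E (u (Suc (r k))) - d (r k) + b (r k)) \<bullet> grad E w = 0" for k
      using split_bregman_u_step[OF sb a w, of "r k"] by (simp add: algebra_simps)
    ultimately show "bl \<bullet> grad E w = 0" by (simp add: LIMSEQ_const_iff)
  next
    \<comment> \<open>The shift to \<open>r (Suc k)\<close> avoids index 0, where the subgradient condition may fail.\<close>
    have "l1_subgradient ?t (d (r (Suc k)) + grad E uf) (b (r (Suc k)))" for k
    proof -
      have "0 < r (Suc k)" using seq_suble[OF r, of "Suc k"] by simp
      then show ?thesis using split_bregman_d_step[OF sb a \<alpha>, of "r (Suc k) - 1"] by simp
    qed
    moreover have "(\<lambda>k. d (r (Suc k)) + grad E uf) \<longlonglongrightarrow> dl + grad E uf"
      using LIMSEQ_Suc[OF dr] by (intro tendsto_intros) (simp add: o_def)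
    moreover have "(\<lambda>k. b (r (Suc k))) \<longlonglongrightarrow> bl"
      using LIMSEQ_Suc[OF br] by (simp add: o_def)
    ultimately have "l1_subgradient ?t (dl + grad E uf) bl"
      by (rule l1_subgradient_limit)
    then show "l1_subgradient ?t (grad E (ul + uf)) bl"
      by (simp add: ul linear_add[OF linear_grad])
  qed
  have "?z \<longlonglongrightarrow> (bl, grad E ul)"
  proof -
    obtain L where L: "?V ul bl \<longlonglongrightarrow> L" using Vconv[OF saddle] by blast
    have "(\<lambda>k. (dist ((?z \<circ> r) k) zl)\<^sup>2) \<longlonglongrightarrow> (dist zl zl)\<^sup>2"
      by (intro tendsto_intros zl)
    then have "(?V ul bl \<circ> r) \<longlonglongrightarrow> 0"
      by (simp add: o_def zl_eq ul)
    then have "L = 0"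
      using LIMSEQ_subseq_LIMSEQ[OF L r] LIMSEQ_unique by blast
    then show ?thesis
      using L tendsto_dist_iff by auto
  qed
  then have b: "b \<longlonglongrightarrow> bl" and d: "d \<longlonglongrightarrow> grad E ul"
    using tendsto_fst tendsto_snd by fastforce+
  have "u \<longlonglongrightarrow> ul"
  proof -
    \<comment> \<open>An injective linear map on a finite-dimensional space is bounded below.\<close>
    obtain m where m: "m > 0" "\<And>w. w \<in> H0 B \<Longrightarrow> m * norm w \<le> norm (grad E w)"
      using injective_imp_isometric[OF closed_subspace[OF subspace_H0] subspace_H0 blin, of B]
        grad_injective_on_H0[OF conn \<open>B \<noteq> {}\<close>] by (metis mult.commute)
    have "(\<lambda>k. grad E (u (Suc k)) - d k + (d k - grad E ul)) \<longlonglongrightarrow> 0 + 0"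
      using d by (intro tendsto_add gap) (simp add: LIM_zero)
    then have "(\<lambda>k. grad E (u (Suc k)) - grad E ul) \<longlonglongrightarrow> 0"
      by simp
    then have lim: "(\<lambda>k. norm (grad E (u (Suc k) - ul)) / m) \<longlonglongrightarrow> 0"
      by (auto simp: linear_diff[OF linear_grad] intro: tendsto_divide_zero tendsto_norm_zero)
    have "norm (u (Suc k) - ul) \<le> norm (grad E (u (Suc k) - ul)) / m" for k
      using m(2)[OF subspace_diff[OF subspace_H0 uH0 ul(1)], of k] m(1) by (simp add: field_simps)
    then have "(\<lambda>k. u (Suc k) - ul) \<longlonglongrightarrow> 0"
      by (intro Lim_null_comparison[OF _ lim]) simp
    then show ?thesis
      by (simp add: LIM_zero_iff filterlim_sequentially_Suc[of u, symmetric])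
  qed
  with that saddle b d show ?thesis by blast
qed

text \<open>Gradients are antisymmetric, the weights are symmetric and shrinkage is odd, so the iteration
  preserves antisymmetry of \<open>b\<close>.\<close>

lemma split_bregman_antisymmetric:
  assumes sb: "split_bregman E B a \<alpha> uf u b d" and a: "measurement_matrix E a"
    and "transpose (b 0) = - b 0"
  shows "b k $ j $ i = - b k $ i $ j"
proof (induction k arbitrary: i j)
  case 0
  have "b 0 $ j $ i = transpose (b 0) $ i $ j" by (simp add: transpose_def)
  also have "\<dots> = - b 0 $ i $ j" unfolding assms(3) by simp
  finally show ?case .
next
  case (Suc k)
  have g: "grad E w $ j $ i = - grad E w $ i $ j" for w by (simp add: grad_def insert_commute)
  have aji: "a $ j $ i = a $ i $ j"
    using a by (simp add: measurement_matrix_def transpose_def vec_eq_iff)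
  define w where "w = grad E (u (Suc k)) $ i $ j + grad E uf $ i $ j + b k $ i $ j"
  have "grad E (u (Suc k)) $ j $ i + grad E uf $ j $ i + b k $ j $ i = - w"
    unfolding w_def g[where w = uf] g[where w = "u (Suc k)"] Suc[of i j] by simp
  then have "d (Suc k) $ j $ i = shrink (a $ i $ j / (2 * \<alpha>)) (- w) - grad E uf $ j $ i"
    using sb by (simp add: split_bregman_def aji)
  moreover have "d (Suc k) $ i $ j = shrink (a $ i $ j / (2 * \<alpha>)) w - grad E uf $ i $ j"
    using sb by (simp add: split_bregman_def w_def)
  ultimately have "d (Suc k) $ j $ i = - d (Suc k) $ i $ j"
    by (simp add: shrink_minus g)
  moreover have "b (Suc k) $ i' $ j' = b k $ i' $ j' + grad E (u (Suc k)) $ i' $ j' - d (Suc k) $ i' $ j'" for i' j'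
    using sb by (simp add: split_bregman_def)
  ultimately show ?case by (simp only: g[of "u (Suc k)"] Suc[of i j])
qed

section \<open>Saddle points solve the primal, dual and inverse problems\<close>

lemma saddle_point_scale:
  assumes "saddle_point E B (s *\<^sub>R a) uf u b" and "s > 0"
  shows "saddle_point E B a uf u ((1 / s) *\<^sub>R b)"
  using assms by (auto simp: saddle_point_def l1_subgradient_def abs_mult field_simps)

lemma saddle_point_HE:
  assumes "measurement_matrix E a" and "saddle_point E B a uf u J"
  shows "J \<in> HE E"
proof -
  have "J $ i $ j = 0" if "a $ i $ j = 0" for i j
  proof -
    have "\<bar>J $ i $ j\<bar> \<le> a $ i $ j" using assms(2) by (simp add: saddle_point_def l1_subgradient_def)
    then show ?thesis using that by simp
  qed
  then show ?thesis using assms(1) by (simp add: measurement_matrix_def HE_def)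
qed

lemma primal_objective_eq:
  assumes "measurement_matrix E a"
  shows "primal_objective a uf w = weighted_l1 a (grad E (w + uf)) / 2"
proof -
  have "a $ i $ j * \<bar>w $ i - w $ j + uf $ i - uf $ j\<bar> = a $ i $ j * \<bar>grad E (w + uf) $ i $ j\<bar>" for i j
    using assms by (auto simp: measurement_matrix_def HE_def grad_def algebra_simps)
  then show ?thesis by (simp only: primal_objective_def weighted_l1_def)
qed

lemma inner_grad_shift:
  assumes "\<forall>w\<in>H0 B. b \<bullet> grad E w = 0" and "w \<in> H0 B"
  shows "b \<bullet> grad E (w + uf) = b \<bullet> grad E uf"
  using assms by (simp add: linear_add[OF linear_grad] inner_add_right)

text \<open>The pairing with \<open>J\<close> is constant on admissible gradients and at most the weighted l1 norm, with
  equality at \<open>u\<close>.\<close>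

lemma saddle_point_primal_solution:
  assumes a: "measurement_matrix E a" and s: "saddle_point E B a uf u J"
  shows "primal_solution B a uf u"
proof -
  have u: "u \<in> H0 B" and orth: "\<forall>w\<in>H0 B. J \<bullet> grad E w = 0"
    using s by (simp_all add: saddle_point_def)
  have "weighted_l1 a (grad E (u + uf)) \<le> weighted_l1 a (grad E (w + uf))" if "w \<in> H0 B" for w
  proof -
    have "weighted_l1 a (grad E (u + uf)) = J \<bullet> grad E (u + uf)"
      using s by (metis saddle_point_def l1_subgradient_inner)
    also have "\<dots> = J \<bullet> grad E (w + uf)"
      by (simp only: inner_grad_shift[OF orth u] inner_grad_shift[OF orth that])
    also have "\<dots> \<le> weighted_l1 a (grad E (w + uf))"
      using s by (intro inner_le_weighted_l1) (simp add: saddle_point_def l1_subgradient_def)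
    finally show ?thesis .
  qed
  then show ?thesis
    using u by (auto simp: primal_solution_def is_arg_min_def primal_objective_eq[OF a] not_less)
qed

text \<open>Weak duality bounds the dual objective by half the weighted l1 norm at \<open>grad E (u + uf)\<close>, and the
  subgradient condition says that \<open>J\<close> attains it.\<close>

lemma saddle_point_dual_solution:
  assumes a: "measurement_matrix E a" and s: "saddle_point E B a uf u J"
  shows "dual_solution E B a uf (- ((1/2) *\<^sub>R J))"
proof -
  have u: "u \<in> H0 B" using s by (simp add: saddle_point_def)
  have orth: "\<forall>w\<in>H0 B. J \<bullet> grad E w = 0" using s by (simp add: saddle_point_def)
  have JE: "- ((1/2) *\<^sub>R J) \<in> HE E" using saddle_point_HE[OF a s] by (simp add: HE_def)
  have "dual_feasible E B a (- ((1/2) *\<^sub>R J))"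
    unfolding dual_feasible_def orthogonal_grad_iff[OF JE, symmetric]
    using JE orth s by (auto simp: saddle_point_def l1_subgradient_def)
  moreover have "- (b \<bullet> grad E uf) \<le> - (- ((1/2) *\<^sub>R J) \<bullet> grad E uf)" if "dual_feasible E B a b" for b
  proof -
    have "\<forall>w\<in>H0 B. b \<bullet> grad E w = 0"
      using that orthogonal_grad_iff[of b E B] by (simp add: dual_feasible_def)
    then have "- (b \<bullet> grad E uf) = (1/2) * ((- 2 *\<^sub>R b) \<bullet> grad E (u + uf))"
      by (simp add: inner_grad_shift u)
    also have "\<dots> \<le> (1/2) * weighted_l1 a (grad E (u + uf))"
    proof (intro mult_left_mono inner_le_weighted_l1)
      fix i j
      have "\<bar>b $ i $ j\<bar> \<le> 1/2 * a $ i $ j" using that unfolding dual_feasible_def by blast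
      then show "\<bar>(- 2 *\<^sub>R b) $ i $ j\<bar> \<le> a $ i $ j" by (simp add: abs_mult)
    qed simp
    also have "\<dots> = (1/2) * (J \<bullet> grad E (u + uf))"
      using s by (metis saddle_point_def l1_subgradient_inner)
    also have "\<dots> = - (- ((1/2) *\<^sub>R J) \<bullet> grad E uf)"
      by (simp add: inner_grad_shift[OF orth u])
    finally show ?thesis .
  qed
  ultimately show ?thesis
    by (auto simp: dual_solution_def is_arg_max_def not_less)
qed

text \<open>On an edge, divide the equation in the subgradient condition by the voltage drop; off the edges
  both sides vanish.\<close>

lemma saddle_point_value:
  assumes a: "measurement_matrix E a" and s: "saddle_point E B a uf u J"
    and v: "(u + uf) $ i \<noteq> (u + uf) $ j"
  shows "J $ i $ j = a $ i $ j * sgn ((u + uf) $ i - (u + uf) $ j)"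
proof (cases "{i, j} \<in> E")
  case True
  define x where "x = (u + uf) $ i - (u + uf) $ j"
  have "J $ i $ j * x = a $ i $ j * \<bar>x\<bar>"
  proof -
    have "grad E (u + uf) $ i $ j = x" using True by (simp add: grad_def x_def)
    then show ?thesis using s unfolding saddle_point_def l1_subgradient_def by metis
  qed
  then have "J $ i $ j * x = a $ i $ j * sgn x * x"
    by (simp add: abs_sgn mult_ac)
  then show ?thesis using v by (simp add: x_def)
next
  case False
  then show ?thesis
    using a saddle_point_HE[OF a s] by (auto simp: measurement_matrix_def HE_def)
qed

text \<open>The multiplier \<open>J\<close> need not be antisymmetric, as the dual constraints do not ask for it. Its
  antisymmetric part has the same divergence, and the same values on edges with a nonzero voltage drop,
  where \<open>J\<close> is antisymmetric by \<open>saddle_point_value\<close>. The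
  conductivity is \<open>a\<close> divided by the modulus of the voltage drop.\<close>

lemma saddle_point_induced_current:
  assumes a: "measurement_matrix E a" and s: "saddle_point E B a uf u J"
  shows "induced_current E B a (u + uf) ((1/2) *\<^sub>R (J - transpose J))"
proof -
  define v where "v = u + uf"
  define K where "K = (1/2) *\<^sub>R (J - transpose J)"
  have K: "K $ i $ j = (J $ i $ j - J $ j $ i) / 2" for i j
    by (simp add: K_def transpose_def)
  have asym: "a $ i $ j = a $ j $ i" and a0: "0 \<le> a $ i $ j" for i j
    using a by (simp_all add: measurement_matrix_def transpose_def vec_eq_iff)
  have JE: "J \<in> HE E" by (rule saddle_point_HE[OF a s])
  then have cur: "current E K"
    by (auto simp: current_def K HE_def insert_commute field_simps)
  have val: "K $ i $ j = a $ i $ j * sgn (v $ i - v $ j)" if "v $ i \<noteq> v $ j" for i j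
    using saddle_point_value[OF a s, of i j] saddle_point_value[OF a s, of j i] that
      sgn_minus[of "v $ i - v $ j"]
    by (simp add: K v_def[symmetric] asym[of j i])
  have "(\<Sum>j\<in>UNIV. K $ i $ j) = 0" if "i \<in> -B" for i
  proof -
    have "(\<Sum>j\<in>UNIV. K $ i $ j) = - dvg J $ i / 2"
      by (simp add: K dvg_def sum_subtractf sum_divide_distrib[symmetric])
    moreover have "dvg J $ i = 0"
      using orthogonal_grad_iff[OF JE, of B] s that by (simp add: saddle_point_def)
    ultimately show ?thesis by simp
  qed
  moreover define \<sigma> :: "ereal^'a^'a" where
    "\<sigma> = (\<chi> i j. if v $ i = v $ j then \<infinity> else ereal (a $ i $ j / \<bar>v $ i - v $ j\<bar>))"
  have "transpose \<sigma> = \<sigma>"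
    by (auto simp: transpose_def \<sigma>_def vec_eq_iff asym abs_minus_commute)
  moreover have "0 \<le> \<sigma> $ i $ j" for i j
    by (simp add: \<sigma>_def a0)
  moreover have "ereal (K $ i $ j) = \<sigma> $ i $ j * ereal (v $ i - v $ j)" if "v $ i \<noteq> v $ j" for i j
    using that by (simp add: \<sigma>_def val real_sgn_eq)
  moreover have "\<sigma> $ i $ j = \<infinity>" if "v $ i = v $ j" for i j
    using that by (simp add: \<sigma>_def)
  moreover have "\<bar>K $ i $ j\<bar> = a $ i $ j" if "v $ i \<noteq> v $ j" for i j
    using that a0[of i j] by (simp add: val abs_mult abs_sgn_eq)
  ultimately show ?thesis
    using cur unfolding induced_current_def v_def[symmetric] K_def[symmetric] by blast
qed

theorem proposition4p1:
  fixes E :: "'n::finite set set" and B :: "'n set" and f :: "'n \<Rightarrow> real"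
    and a :: "real^'n^'n" and \<alpha> :: real and uf :: "real^'n"
    and u :: "nat \<Rightarrow> real^'n" and b d :: "nat \<Rightarrow> real^'n^'n"
  assumes "simple_graph E" and "connected_graph E" and "B \<noteq> {}"
    and "measurement_matrix E a"
    and "\<alpha> > 0"
    and "\<forall>i\<in>B. uf $ i = f i"
    and "split_bregman E B a \<alpha> uf u b d"
  shows "\<exists>ul J.
    u \<longlonglongrightarrow> ul \<and>
    b \<longlonglongrightarrow> (1 / (2 * \<alpha>)) *\<^sub>R J \<and>
    d \<longlonglongrightarrow> grad E ul \<and>
    primal_solution B a uf ul \<and>
    dual_solution E B a uf (- ((1/2) *\<^sub>R J)) \<and>
    ul + uf \<in> voltage_potentials E B f a \<and>
    (\<forall>i j. (ul + uf) $ i \<noteq> (ul + uf) $ j \<longrightarrow> \<bar>J $ i $ j\<bar> = a $ i $ j) \<and>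
    (transpose (b 0) = - b 0 \<longrightarrow> induced_current E B a (ul + uf) J)"
proof -
  obtain ul bl where s: "saddle_point E B ((1 / (2 * \<alpha>)) *\<^sub>R a) uf ul bl"
    and lim: "u \<longlonglongrightarrow> ul" "b \<longlonglongrightarrow> bl" "d \<longlonglongrightarrow> grad E ul"
    using split_bregman_converges[OF assms(2,3,4,5,7)] by blast
  define J where "J = (2 * \<alpha>) *\<^sub>R bl"
  have sJ: "saddle_point E B a uf ul J"
    using saddle_point_scale[OF s] assms(5) by (simp add: J_def)
  have bl: "bl = (1 / (2 * \<alpha>)) *\<^sub>R J"
    using assms(5) by (simp add: J_def)
  have ind: "induced_current E B a (ul + uf) ((1/2) *\<^sub>R (J - transpose J))"
    by (rule saddle_point_induced_current[OF assms(4) sJ])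
  have volt: "ul + uf \<in> voltage_potentials E B f a"
    using ind assms(6) sJ by (auto simp: voltage_potentials_def saddle_point_def H0_def)
  have abs_J: "\<bar>J $ i $ j\<bar> = a $ i $ j" if "(ul + uf) $ i \<noteq> (ul + uf) $ j" for i j
    using saddle_point_value[OF assms(4) sJ that] that assms(4)
    by (simp add: abs_mult abs_sgn_eq measurement_matrix_def)
  have "induced_current E B a (ul + uf) J" if "transpose (b 0) = - b 0"
  proof -
    have anti: "bl $ j $ i = - bl $ i $ j" for i j
    proof (rule LIMSEQ_unique)
      show "(\<lambda>k. b k $ j $ i) \<longlonglongrightarrow> bl $ j $ i"
        by (intro tendsto_intros lim)
      show "(\<lambda>k. b k $ j $ i) \<longlonglongrightarrow> - bl $ i $ j"
        unfolding split_bregman_antisymmetric[OF assms(7,4) that, of _ j i]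
        by (intro tendsto_intros lim)
    qed
    have "((1/2) *\<^sub>R (J - transpose J)) $ i $ j = J $ i $ j" for i j
      by (simp add: transpose_def J_def anti[of j i])
    then have "(1/2) *\<^sub>R (J - transpose J) = J"
      by (simp only: vec_eq_iff) simp
    then show ?thesis using ind by simp
  qed
  then show ?thesis
    using lim bl sJ volt abs_J saddle_point_primal_solution[OF assms(4) sJ]
      saddle_point_dual_solution[OF assms(4) sJ] by blast
qed

end
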